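(* Let $A$ be a finite totally ordered alphabet, $m\colon A\to\mathbb{Z}^{+}$, and $\mathcal{S}_{(A,m)}$ the set of words in which each $a\in A$ occurs exactly $m(a)$ times. Define $\delta(w)=\{(w_i,\mathtt{d}(w_i),\mathtt{p}(w_i),\mathtt{r}(w_i)) : 1\le i\le n\}$ for $w=w_1\cdots w_n\in\mathcal{S}_{(A,m)}$, and let $L_{\mathcal{S}_{(A,m)}}=\{\delta(w): w\in\mathcal{S}_{(A,m)}\}$. Then $\delta\colon\mathcal{S}_{(A,m)}\to L_{\mathcal{S}_{(A,m)}}$ is a bijection.
   Context: For $w=w_1\cdots w_n$: the duplicate index $\mathtt{d}(w_i)=|\{j\le i: w_j=w_i\}|$ (equal letters are numbered $1,2,\dots$ from left to right). Descent blocks: cut $w$ between $w_i$ and $w_{i+1}$ whenever $w_i\le w_{i+1}$; the maximal pieces are the descent blocks. A block with one letter is an outsider block; for a block $B$ with at least two letters, its leftmost letter is its closer $C(B)$, its rightmost letter its opener $O(B)$, and letters strictly inside are insiders. The position $\mathtt{p}(w_i)\in\{\text{opener},\text{closer},\text{insider},\text{outsider}\}$ records which of these roles $w_i$ has (outsider if its block has one letter). A letter $a$ is embraced by a block $B$ with at least two letters if $O(B)<a<C(B)$; the right embracing number $\mathtt{r}(w_i)$ is the number of descent blocks lying strictly to the right of $w_i$ that embrace $w_i$. *)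

theory Defs
  imports Main
begin

definition words_over :: "'a::linorder set \<Rightarrow> ('a \<Rightarrow> nat) \<Rightarrow> 'a list set" where
  "words_over A m = {w. set w \<subseteq> A \<and> (\<forall>a\<in>A. count_list w a = m a)}"

text \<open>Positions in a word are counted from 0, so the letter \<open>w\<^sub>i\<close> is \<open>w ! (i - 1)\<close>.
  The duplicate index itself still starts at 1.\<close>

definition dup_index :: "'a::linorder list \<Rightarrow> nat \<Rightarrow> nat" where
  "dup_index w i = card {j. j \<le> i \<and> w ! j = w ! i}"

text \<open>A descent block is represented by the pair of its first and last position, so that equal
  factors occurring at different places count as different blocks.\<close>

definition cut_after :: "'a::linorder list \<Rightarrow> nat \<Rightarrow> bool" where
  "cut_after w i \<longleftrightarrow> Suc i < length w \<and> w ! i \<le> w ! Suc i"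

definition descent_blocks :: "'a::linorder list \<Rightarrow> (nat \<times> nat) set" where
  "descent_blocks w = {(l, r). l \<le> r \<and> r < length w
     \<and> (\<forall>k. l \<le> k \<and> k < r \<longrightarrow> \<not> cut_after w k)
     \<and> (l = 0 \<or> cut_after w (l - 1))
     \<and> (Suc r = length w \<or> cut_after w r)}"

datatype role = Opener | Closer | Insider | Outsider

definition role_of :: "'a::linorder list \<Rightarrow> nat \<Rightarrow> role" where
  "role_of w i =
    (if (i, i) \<in> descent_blocks w then Outsider
     else if \<exists>r. (i, r) \<in> descent_blocks w then Closer
     else if \<exists>l. (l, i) \<in> descent_blocks w then Opener
     else Insider)"

text \<open>The closer of a block \<open>(l, r)\<close> is the letter \<open>w ! l\<close>, its opener is \<open>w ! r\<close>.\<close>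

definition embraces :: "'a::linorder list \<Rightarrow> nat \<times> nat \<Rightarrow> 'a \<Rightarrow> bool" where
  "embraces w B a \<longleftrightarrow> fst B < snd B \<and> w ! snd B < a \<and> a < w ! fst B"

definition right_embracing :: "'a::linorder list \<Rightarrow> nat \<Rightarrow> nat" where
  "right_embracing w i = card {B \<in> descent_blocks w. i < fst B \<and> embraces w B (w ! i)}"

definition delta :: "'a::linorder list \<Rightarrow> ('a \<times> nat \<times> role \<times> nat) set" where
  "delta w = {(w ! i, dup_index w i, role_of w i, right_embracing w i) | i. i < length w}"

definition L_words :: "'a::linorder set \<Rightarrow> ('a \<Rightarrow> nat) \<Rightarrow> ('a \<times> nat \<times> role \<times> nat) set set" where
  "L_words A m = {delta w | w. w \<in> words_over A m}"

end

theory Submission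
  imports Defs
begin

text \<open>Scan the letters of a word in increasing order, keeping the left-to-right list of the descent
  blocks cut down to the letters seen so far, each marked open if its closer is still to come.
  A copy of the next letter \<open>a\<close> which is an insider or a closer extends an open block; a copy which
  is an opener or an outsider starts a new block, and since the block following it has a closer
  that is at least \<open>a\<close>, the new block sits directly in front of an open block, of another new
  block, or at the end. So in every case the place of the copy is fixed by the number of
  open blocks to its right, which is its right embracing number plus the number of later copies
  of \<open>a\<close> that are closers.\<close>

section \<open>Words as lists of descent blocks\<close>

text \<open>The inequality between neighbours is the cut condition, so the entries of a block list
  are exactly the descent blocks of its concatenation.\<close>

fun block_list :: "'a::linorder list list \<Rightarrow> bool" where
  "block_list [] \<longleftrightarrow> True"
| "block_list (B # Bs) \<longleftrightarrow> B \<noteq> [] \<and> sorted_wrt (>) B \<and>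
     (Bs \<noteq> [] \<longrightarrow> last B \<le> hd (hd Bs)) \<and> block_list Bs"

lemma block_list_nonempty: "block_list Bs \<Longrightarrow> B \<in> set Bs \<Longrightarrow> B \<noteq> []"
  by (induction Bs) auto

text \<open>A letter put in front becomes a block of its own if it is at most the head of the first
  block, and otherwise lengthens that block.\<close>

lemma block_list_exists: "\<exists>Bs. block_list Bs \<and> concat Bs = w"
proof (induction w)
  case Nil
  then show ?case by (intro exI[of _ "[]"]) simp
next
  case (Cons x w)
  then obtain Bs where Bs: "block_list Bs" "concat Bs = w" by blast
  show ?case
  proof (cases Bs)
    case Nil
    then show ?thesis using Bs by (intro exI[of _ "[[x]]"]) simp
  next
    case (Cons B Cs)
    then have "B \<noteq> []" using Bs by simp
    show ?thesis
    proof (cases "x \<le> hd B")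
      case True
      then show ?thesis using Bs Cons by (intro exI[of _ "[x] # Bs"]) simp
    next
      case False
      have "y \<le> hd B" if "y \<in> set B" for y
        using that Bs Cons by (cases B) auto
      then have "sorted_wrt (>) (x # B)" using Bs Cons False by (fastforce simp: not_le)
      then show ?thesis using Bs Cons \<open>B \<noteq> []\<close>
        by (intro exI[of _ "(x # B) # Cs"]) simp
    qed
  qed
qed

lemma decreasing_le_hd: "sorted_wrt (>) (B :: 'a::linorder list) \<Longrightarrow> x \<in> set B \<Longrightarrow> x \<le> hd B"
  by (cases B) auto

lemma decreasing_ge_last: "sorted_wrt (>) (B :: 'a::linorder list) \<Longrightarrow> x \<in> set B \<Longrightarrow> last B \<le> x"
  by (induction B) (auto simp: less_imp_le)

lemma decreasing_last_less_hd:
  "sorted_wrt (>) (B :: 'a::linorder list) \<Longrightarrow> B \<noteq> [] \<Longrightarrow> last B < hd B \<longleftrightarrow> length B \<noteq> 1"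
  by (cases B) auto

lemma decreasing_nth_eq_iff:
  "sorted_wrt (>) (B :: 'a::linorder list) \<Longrightarrow> i < length B \<Longrightarrow> j < length B \<Longrightarrow> B ! i = B ! j \<longleftrightarrow> i = j"
  using sorted_wrt_nth_less[of "(>)" B i j] sorted_wrt_nth_less[of "(>)" B j i]
  by (cases i j rule: linorder_cases) auto

section \<open>Descent blocks, roles and embracing after splitting off the first block\<close>

definition shift :: "nat \<Rightarrow> nat \<times> nat \<Rightarrow> nat \<times> nat" where
  "shift n p = (n + fst p, n + snd p)"

lemma inj_shift: "inj_on (shift n) X"
  by (auto simp: inj_on_def shift_def prod_eq_iff)

text \<open>The situation of an induction over a block list: \<open>B\<close> is the first descent
  block and \<open>w\<close> the rest, possibly empty.\<close>

locale first_block =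
  fixes B w :: "'a::linorder list"
  assumes nonempty: "B \<noteq> []"
    and decreasing: "sorted_wrt (>) B"
    and cut: "w \<noteq> [] \<Longrightarrow> last B \<le> hd w"
begin

lemma cut_after_iff:
  "cut_after (B @ w) k \<longleftrightarrow>
    (if Suc k < length B then False
     else if Suc k = length B then w \<noteq> []
     else cut_after w (k - length B))"
proof -
  consider (inside) "Suc k < length B" | (boundary) "Suc k = length B" | (beyond) "length B \<le> k"
    by linarith
  then show ?thesis
  proof cases
    case inside
    then have "B ! Suc k < B ! k" using sorted_wrt_nth_less[OF decreasing, of k "Suc k"] by simp
    then show ?thesis using inside by (simp add: cut_after_def nth_append)
  next
    case boundary
    then have "k = length B - 1" by simp
    then have "B ! k = last B" using nonempty by (simp add: last_conv_nth)
    then show ?thesis using boundary cut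
      by (auto simp: cut_after_def nth_append hd_conv_nth)
  next
    case beyond
    then show ?thesis by (auto simp: cut_after_def nth_append Suc_diff_le)
  qed
qed

text \<open>There is no cut inside \<open>B\<close> and there is one at its end if \<open>w\<close>
  is nonempty, so no block crosses the boundary.\<close>

lemma blocks_append:
  "descent_blocks (B @ w) = insert (0, length B - 1) (shift (length B) ` descent_blocks w)"
    (is "?L = insert ?p ?R")
proof (rule set_eqI, rule iffI)
  fix p assume p: "p \<in> ?L"
  obtain l r where lr: "p = (l, r)" by (cases p)
  have b: "l \<le> r" "r < length B + length w"
    and nocut: "\<And>k. l \<le> k \<Longrightarrow> k < r \<Longrightarrow> \<not> cut_after (B @ w) k"
    and left: "l = 0 \<or> cut_after (B @ w) (l - 1)"
    and right: "Suc r = length (B @ w) \<or> cut_after (B @ w) r"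
    using p lr by (auto simp: descent_blocks_def)
  show "p \<in> insert ?p ?R"
  proof (cases "l < length B")
    case True
    then have "l = 0" using left by (auto simp: cut_after_iff split: if_splits)
    have "\<not> Suc r < length B" using right by (auto simp: cut_after_iff)
    moreover have "\<not> length B \<le> r"
    proof
      assume *: "length B \<le> r"
      then have "w \<noteq> []" using b by auto
      moreover have "\<not> cut_after (B @ w) (length B - 1)"
        using * True nonempty by (intro nocut) (auto simp: Suc_le_eq)
      ultimately show False using nonempty by (auto simp: cut_after_iff)
    qed
    ultimately have "r = length B - 1" by linarith
    then show ?thesis using lr \<open>l = 0\<close> by simp
  next
    case False
    define l' r' where "l' = l - length B" and "r' = r - length B"
    have eq: "l = length B + l'" "r = length B + r'" using False b by (auto simp: l'_def r'_def)
    have "\<not> cut_after w k" if "l' \<le> k" "k < r'" for k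
      using nocut[of "length B + k"] that eq by (auto simp: cut_after_iff)
    moreover have "l' = 0 \<or> cut_after w (l' - 1)"
      using left eq nonempty by (cases l') (auto simp: cut_after_iff)
    moreover have "Suc r' = length w \<or> cut_after w r'"
      using right eq by (auto simp: cut_after_iff)
    ultimately have "(l', r') \<in> descent_blocks w"
      using b eq by (auto simp: descent_blocks_def)
    then show ?thesis using lr eq by (auto simp: shift_def image_iff intro!: bexI[of _ "(l', r')"])
  qed
next
  fix p assume "p \<in> insert ?p ?R"
  then consider "p = ?p" | l r where "(l, r) \<in> descent_blocks w" "p = shift (length B) (l, r)"
    by auto
  then show "p \<in> ?L"
  proof cases
    case 1
    moreover have "length B - 1 < length B" using nonempty by simp
    ultimately show ?thesis by (auto simp: descent_blocks_def cut_after_iff)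
  next
    case 2
    then have b: "l \<le> r" "r < length w"
      and nocut: "\<And>k. l \<le> k \<Longrightarrow> k < r \<Longrightarrow> \<not> cut_after w k"
      and left: "l = 0 \<or> cut_after w (l - 1)"
      and right: "Suc r = length w \<or> cut_after w r"
      by (auto simp: descent_blocks_def)
    have "\<not> cut_after (B @ w) k" if "length B + l \<le> k" "k < length B + r" for k
      using nocut[of "k - length B"] that by (auto simp: cut_after_iff)
    \<comment> \<open>For \<open>l = 0\<close> this is the boundary cut, present because
      \<open>r < length w\<close> makes \<open>w\<close> nonempty.\<close>
    moreover have "cut_after (B @ w) (length B + l - 1)"
      using left b nonempty by (cases l) (auto simp: cut_after_iff)
    moreover have "Suc (length B + r) = length (B @ w) \<or> cut_after (B @ w) (length B + r)"
      using right by (auto simp: cut_after_iff)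
    ultimately show ?thesis using b 2 by (auto simp: descent_blocks_def shift_def)
  qed
qed

lemma mem_blocks_beyond:
  "(length B + l, length B + r) \<in> descent_blocks (B @ w) \<longleftrightarrow> (l, r) \<in> descent_blocks w"
  using nonempty by (force simp: blocks_append shift_def image_iff)

lemma mem_blocks_left:
  "i < length B \<Longrightarrow> (i, r) \<in> descent_blocks (B @ w) \<longleftrightarrow> i = 0 \<and> r = length B - 1"
  by (auto simp: blocks_append shift_def)

lemma mem_blocks_right:
  "i < length B \<Longrightarrow> (l, i) \<in> descent_blocks (B @ w) \<longleftrightarrow> l = 0 \<and> i = length B - 1"
  by (auto simp: blocks_append shift_def)

lemma role_of_beyond: "role_of (B @ w) (length B + i) = role_of w i"
proof -
  have "length B + i \<noteq> length B - 1" using nonempty by (cases B) auto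
  then have "(\<exists>l. (l, length B + i) \<in> descent_blocks (B @ w)) \<longleftrightarrow> (\<exists>l. (l, i) \<in> descent_blocks w)"
    by (force simp: blocks_append shift_def image_iff)
  moreover have "(\<exists>r. (length B + i, r) \<in> descent_blocks (B @ w)) \<longleftrightarrow> (\<exists>r. (i, r) \<in> descent_blocks w)"
    using nonempty by (force simp: blocks_append shift_def image_iff)
  ultimately show ?thesis by (simp add: role_of_def mem_blocks_beyond)
qed

lemma embraces_shift:
  "embraces (B @ w) (shift (length B) p) a \<longleftrightarrow> embraces w p a"
  by (simp add: embraces_def shift_def nth_append)

text \<open>The block of \<open>B\<close> starts at 0 and never lies to the right, so only shifted
  blocks of \<open>w\<close> are counted.\<close>

lemma right_embracing_beyond:
  assumes "i < length w"
  shows "right_embracing (B @ w) (length B + i) = right_embracing w i"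
proof -
  have "{p \<in> descent_blocks (B @ w). length B + i < fst p \<and> embraces (B @ w) p ((B @ w) ! (length B + i))}
      = shift (length B) ` {p \<in> descent_blocks w. i < fst p \<and> embraces w p (w ! i)}"
    using nonempty by (auto simp: blocks_append embraces_shift) (auto simp: shift_def image_iff embraces_shift)
  then show ?thesis by (simp add: right_embracing_def card_image inj_shift)
qed

lemma right_embracing_first:
  assumes "i < length B"
  shows "right_embracing (B @ w) i = card {p \<in> descent_blocks w. embraces w p (B ! i)}"
proof -
  have "{p \<in> descent_blocks (B @ w). i < fst p \<and> embraces (B @ w) p ((B @ w) ! i)}
      = shift (length B) ` {p \<in> descent_blocks w. embraces w p (B ! i)}"
    using assms by (auto simp: blocks_append embraces_shift nth_append) (auto simp: shift_def)
  then show ?thesis by (simp add: right_embracing_def card_image inj_shift)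
qed

end

lemma first_block_concat: "block_list (B # Bs) \<Longrightarrow> first_block B (concat Bs)"
  by (cases Bs) (auto simp: first_block_def)

lemma finite_descent_blocks: "finite (descent_blocks w)"
  by (rule finite_subset[of _ "{..length w} \<times> {..length w}"]) (auto simp: descent_blocks_def)

text \<open>In a block list the two strict inequalities force at least two letters, in agreement
  with \<open>embraces\<close>.\<close>

definition embracing_count :: "'a::linorder \<Rightarrow> 'a list list \<Rightarrow> nat" where
  "embracing_count a Bs = length (filter (\<lambda>B. last B < a \<and> a < hd B) Bs)"

lemma card_embracing_blocks:
  "block_list Bs \<Longrightarrow>
    card {p \<in> descent_blocks (concat Bs). embraces (concat Bs) p a} = embracing_count a Bs"
proof (induction Bs)
  case Nil
  then show ?case by (simp add: embracing_count_def descent_blocks_def)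
next
  case (Cons B Bs)
  let ?w = "concat Bs"
  interpret first_block B ?w using Cons.prems by (rule first_block_concat)
  let ?p = "(0, length B - 1)"
  let ?E = "{p \<in> descent_blocks ?w. embraces ?w p a}"
  have "last B < hd B \<longleftrightarrow> 0 < length B - 1"
    using decreasing_last_less_hd[OF decreasing nonempty] nonempty by (cases B) auto
  then have p: "embraces (B @ ?w) ?p a \<longleftrightarrow> last B < a \<and> a < hd B"
    using nonempty by (auto simp: embraces_def nth_append last_conv_nth hd_conv_nth)
  have "{p \<in> descent_blocks (B @ ?w). embraces (B @ ?w) p a}
      = (if embraces (B @ ?w) ?p a then {?p} else {}) \<union> shift (length B) ` ?E"
    by (auto simp: blocks_append embraces_shift)
  moreover have "?p \<notin> shift (length B) ` ?E"
    using nonempty by (auto simp: shift_def)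
  ultimately have "card {p \<in> descent_blocks (B @ ?w). embraces (B @ ?w) p a}
      = (if embraces (B @ ?w) ?p a then 1 else 0) + card ?E"
    by (simp add: card_image inj_shift finite_descent_blocks)
  then show ?case using Cons p by (simp add: embracing_count_def)
qed

section \<open>The labels of a letter\<close>

text \<open>A strictly decreasing block contains each letter at most once, so the role can be read
  off the value instead of the position.\<close>

definition role_in :: "'a::linorder list \<Rightarrow> 'a \<Rightarrow> role" where
  "role_in B a = (if length B = 1 then Outsider else if a = hd B then Closer
     else if a = last B then Opener else Insider)"

text \<open>For a block list, one entry per copy of \<open>a\<close> from left to right, so the
  place of an entry encodes the duplicate index. Counting in the tail \<open>Bs\<close> alone gives
  the blocks strictly to the right.\<close>

fun labels :: "'a::linorder \<Rightarrow> 'a list list \<Rightarrow> (role \<times> nat) list" where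
  "labels a [] = []"
| "labels a (B # Bs) =
    (if a \<in> set B then [(role_in B a, embracing_count a Bs)] else []) @ labels a Bs"

section \<open>Positions of the copies of a letter and duplicate indices\<close>

definition positions :: "'a list \<Rightarrow> 'a \<Rightarrow> nat list" where
  "positions w a = filter (\<lambda>i. w ! i = a) [0..<length w]"

lemma upt_split_at: "i < n \<Longrightarrow> [0..<n] = [0..<i] @ i # [Suc i..<n]"
  using upt_add_eq_append[of 0 i "n - i"] by (simp add: upt_conv_Cons)

lemma positions_append:
  "positions (u @ w) a = positions u a @ map ((+) (length u)) (positions w a)"
proof -
  have "[0..<length u + length w] = [0..<length u] @ map ((+) (length u)) [0..<length w]"
    by (rule nth_equalityI) (auto simp: nth_append)
  then show ?thesis
    by (auto simp: positions_def filter_map o_def nth_append intro!: filter_cong)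
qed

lemma positions_decreasing:
  fixes B :: "'a::linorder list"
  assumes "sorted_wrt (>) B" "i < length B"
  shows "positions B (B ! i) = [i]"
proof -
  have "positions B (B ! i) = filter (\<lambda>j. j = i) [0..<length B]"
    using assms decreasing_nth_eq_iff[OF assms(1)] by (auto simp: positions_def intro!: filter_cong)
  also have "[0..<length B] = [0..<i] @ i # [Suc i..<length B]"
    using assms(2) by (rule upt_split_at)
  finally show ?thesis by (auto simp: filter_empty_conv)
qed

lemma positions_Nil: "a \<notin> set w \<Longrightarrow> positions w a = []"
  by (auto simp: positions_def filter_empty_conv)

lemma labels_eq:
  "block_list Bs \<Longrightarrow> labels a Bs =
    map (\<lambda>i. (role_of (concat Bs) i, right_embracing (concat Bs) i)) (positions (concat Bs) a)"
proof (induction Bs)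
  case Nil
  then show ?case by (simp add: positions_def)
next
  case (Cons B Bs)
  let ?w = "concat Bs"
  interpret first_block B ?w using Cons.prems by (rule first_block_concat)
  let ?f = "\<lambda>w i. (role_of w i, right_embracing w i)"
  have beyond: "map (?f (B @ ?w)) (map ((+) (length B)) (positions ?w a)) = map (?f ?w) (positions ?w a)"
    by (auto simp: role_of_beyond right_embracing_beyond positions_def)
  have first: "map (?f (B @ ?w)) (positions B a)
      = (if a \<in> set B then [(role_in B a, embracing_count a Bs)] else [])"
  proof (cases "a \<in> set B")
    case True
    then obtain i where i: "i < length B" "B ! i = a" by (auto simp: in_set_conv_nth)
    \<comment> \<open>Letters of \<open>B\<close> are distinct, so being at an end of the block is
      the same as being equal to the letter there.\<close>
    have "i = 0 \<longleftrightarrow> a = hd B"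
      using decreasing_nth_eq_iff[OF decreasing i(1), of 0] i nonempty by (auto simp: hd_conv_nth)
    moreover have "i = length B - 1 \<longleftrightarrow> a = last B"
      using decreasing_nth_eq_iff[OF decreasing i(1), of "length B - 1"] i nonempty
      by (auto simp: last_conv_nth)
    moreover have "length B = 1 \<longleftrightarrow> length B - 1 = 0" using i(1) by linarith
    ultimately have "role_of (B @ ?w) i = role_in B a"
      using i(1)
      by (auto simp: role_of_def role_in_def mem_blocks_left mem_blocks_right)
    moreover have "right_embracing (B @ ?w) i = embracing_count a Bs"
      using right_embracing_first[OF i(1)] card_embracing_blocks Cons.prems i(2) by auto
    ultimately show ?thesis using True positions_decreasing[OF decreasing i(1)] i(2) by simp
  next
    case False
    then show ?thesis by (simp add: positions_Nil)
  qed
  show ?case using Cons beyond first by (simp add: positions_append)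
qed

text \<open>The entries of \<open>positions w (w ! i)\<close> before \<open>i\<close> are the
  earlier copies. There are \<open>dup_index w i - 1\<close> of them, as duplicates are numbered
  from 1 and list entries from 0.\<close>

lemma nth_positions:
  assumes "i < length w"
  shows "dup_index w i - 1 < length (positions w (w ! i))"
    and "positions w (w ! i) ! (dup_index w i - 1) = i"
    and "dup_index w i > 0"
proof -
  let ?P = "\<lambda>j. w ! j = w ! i"
  have "[0..<length w] = [0..<i] @ i # [Suc i..<length w]"
    using assms by (rule upt_split_at)
  then have pos: "positions w (w ! i) = filter ?P [0..<i] @ i # filter ?P [Suc i..<length w]"
    by (simp add: positions_def)
  have "{j. j \<le> i \<and> ?P j} = insert i {j. j < i \<and> ?P j}" by auto
  then have "dup_index w i = Suc (card {j. j < i \<and> ?P j})" by (simp add: dup_index_def)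
  also have "{j. j < i \<and> ?P j} = set (filter ?P [0..<i])" by auto
  also have "card \<dots> = length (filter ?P [0..<i])" by (intro distinct_card) simp
  finally have "dup_index w i = Suc (length (filter ?P [0..<i]))" .
  then show "dup_index w i - 1 < length (positions w (w ! i))"
    "positions w (w ! i) ! (dup_index w i - 1) = i" "dup_index w i > 0"
    using pos by (simp_all add: nth_append)
qed

lemma dup_index_nth_positions:
  assumes "k < length (positions w a)"
  shows "dup_index w (positions w a ! k) = Suc k"
proof -
  let ?i = "positions w a ! k"
  have "?i \<in> set (positions w a)" using assms by simp
  then have i: "?i < length w" "w ! ?i = a" by (auto simp: positions_def)
  have "distinct (positions w a)" by (simp add: positions_def)
  then have "dup_index w ?i - 1 = k"
    using nth_positions(1,2)[OF i(1)] assms unfolding i(2) by (simp only: nth_eq_iff_index_eq)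
  then show ?thesis using nth_positions(3)[OF i(1)] by linarith
qed

text \<open>The set \<open>delta\<close> carries the same information as the label lists of all
  letters. The condition \<open>0 < d\<close> is there because \<open>d - 1\<close> truncates:
  \<open>d = 0\<close> would point to the first entry.\<close>

lemma mem_delta_iff:
  assumes "block_list Bs"
  shows "(a, d, x) \<in> delta (concat Bs) \<longleftrightarrow>
    0 < d \<and> d - 1 < length (labels a Bs) \<and> labels a Bs ! (d - 1) = x" (is "?L \<longleftrightarrow> ?R")
proof
  assume ?L
  then obtain i where "i < length (concat Bs)" "a = concat Bs ! i" "d = dup_index (concat Bs) i"
    "x = (role_of (concat Bs) i, right_embracing (concat Bs) i)"
    by (auto simp: delta_def)
  then show ?R using nth_positions[of i "concat Bs"] by (simp add: labels_eq[OF assms])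
next
  assume R: ?R
  let ?i = "positions (concat Bs) a ! (d - 1)"
  have k: "d - 1 < length (positions (concat Bs) a)" using R by (simp add: labels_eq[OF assms])
  then have "?i \<in> set (positions (concat Bs) a)" by simp
  then have "?i < length (concat Bs)" "concat Bs ! ?i = a" by (auto simp: positions_def)
  moreover have "dup_index (concat Bs) ?i = d" using dup_index_nth_positions[OF k] R by simp
  moreover have "x = (role_of (concat Bs) ?i, right_embracing (concat Bs) ?i)"
    using R k by (simp add: labels_eq[OF assms])
  ultimately show ?L unfolding delta_def by (intro CollectI exI[of _ ?i]) simp
qed

lemma labels_eq_if_delta_eq:
  assumes "block_list Bs" "block_list Cs" "delta (concat Bs) = delta (concat Cs)"
  shows "labels a Bs = labels a Cs"
proof -
  have *: "k < length (labels a Bs) \<and> labels a Bs ! k = x \<longleftrightarrow>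
      k < length (labels a Cs) \<and> labels a Cs ! k = x" for k x
    using mem_delta_iff[OF assms(1), of a "Suc k" x] mem_delta_iff[OF assms(2), of a "Suc k" x] assms(3)
    by simp
  then have "k < length (labels a Bs) \<longleftrightarrow> k < length (labels a Cs)" for k by blast
  then have "length (labels a Bs) = length (labels a Cs)" by (metis linorder_neqE_nat less_irrefl)
  then show ?thesis using * by (intro nth_equalityI) blast+
qed

section \<open>Counting open blocks\<close>

text \<open>In the scan these are the blocks already started before \<open>a\<close> whose closer is
  still to come. Unlike \<open>embracing_count\<close>, this includes blocks closed by
  \<open>a\<close> itself.\<close>

definition open_count :: "'a::linorder \<Rightarrow> 'a list list \<Rightarrow> nat" where
  "open_count a Bs = length (filter (\<lambda>B. last B < a \<and> a \<le> hd B) Bs)"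

fun open_labels :: "'a::linorder \<Rightarrow> 'a list list \<Rightarrow> (role \<times> nat) list" where
  "open_labels a [] = []"
| "open_labels a (B # Bs) =
    (if a \<in> set B then [(role_in B a, open_count a Bs)] else []) @ open_labels a Bs"

definition closers :: "(role \<times> nat) list \<Rightarrow> nat" where
  "closers xs = length (filter (\<lambda>x. fst x = Closer) xs)"

text \<open>The correction from right embracing numbers to open counts: each copy gains the closers
  among the later copies.\<close>

fun add_closers :: "(role \<times> nat) list \<Rightarrow> (role \<times> nat) list" where
  "add_closers [] = []"
| "add_closers (x # xs) = (fst x, snd x + closers xs) # add_closers xs"

lemma role_in_cases:
  assumes "sorted_wrt (>) B" "a \<in> set B"
  shows "role_in B a = Outsider \<longleftrightarrow> last B = a \<and> a = hd B"
    and "role_in B a = Closer \<longleftrightarrow> last B < a \<and> a = hd B"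
    and "role_in B a = Opener \<longleftrightarrow> last B = a \<and> a < hd B"
    and "role_in B a = Insider \<longleftrightarrow> last B < a \<and> a < hd B"
proof -
  have "B \<noteq> []" using assms by auto
  with assms(1) have *: "last B < hd B \<longleftrightarrow> length B \<noteq> 1" by (rule decreasing_last_less_hd)
  have "a \<le> hd B" "last B \<le> a"
    using assms by (auto intro: decreasing_le_hd decreasing_ge_last)
  with * show "role_in B a = Outsider \<longleftrightarrow> last B = a \<and> a = hd B"
    "role_in B a = Closer \<longleftrightarrow> last B < a \<and> a = hd B"
    "role_in B a = Opener \<longleftrightarrow> last B = a \<and> a < hd B"
    "role_in B a = Insider \<longleftrightarrow> last B < a \<and> a < hd B"
    by (auto simp: role_in_def)
qed

text \<open>An open block either has a closer above \<open>a\<close>, and embraces \<open>a\<close>,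
  or is closed by a copy of \<open>a\<close>, which then has the label
  \<open>Closer\<close>.\<close>

lemma open_count_eq:
  "block_list Bs \<Longrightarrow> open_count a Bs = embracing_count a Bs + closers (labels a Bs)"
proof (induction Bs)
  case Nil
  then show ?case by (simp add: open_count_def embracing_count_def closers_def)
next
  case (Cons B Bs)
  have "hd B \<in> set B" using Cons.prems by simp
  then show ?case using Cons role_in_cases(2)[of B a]
    by (auto simp: open_count_def embracing_count_def closers_def)
qed

lemma open_labels_eq: "block_list Bs \<Longrightarrow> open_labels a Bs = add_closers (labels a Bs)"
  by (induction Bs) (auto simp: open_count_eq)

text \<open>A copy counts only open blocks to its right. The bound is strict for an insider or
  closer because its own block is open too and is not counted.\<close>

lemma open_labels_bound:
  assumes "block_list Bs" "(\<rho>, k) \<in> set (open_labels a Bs)"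
  shows "k \<le> open_count a Bs"
    and "\<rho> = Insider \<or> \<rho> = Closer \<Longrightarrow> k < open_count a Bs"
proof -
  have "k \<le> open_count a Bs \<and> (\<rho> = Insider \<or> \<rho> = Closer \<longrightarrow> k < open_count a Bs)"
    using assms
  proof (induction Bs)
    case (Cons B Bs)
    show ?case
    proof (cases "(\<rho>, k) \<in> set (open_labels a Bs)")
      case True
      then show ?thesis using Cons by (auto simp: open_count_def)
    next
      case False
      then have "a \<in> set B" "\<rho> = role_in B a" "k = open_count a Bs"
        using Cons.prems by (auto split: if_splits)
      then show ?thesis using Cons.prems role_in_cases[of B a] by (auto simp: open_count_def)
    qed
  qed simp
  then show "k \<le> open_count a Bs" "\<rho> = Insider \<or> \<rho> = Closer \<Longrightarrow> k < open_count a Bs" by auto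
qed

section \<open>Reconstruction\<close>

text \<open>The flag of a restricted block records whether the block is open, i.e. its closer is not in \<open>U\<close>.\<close>

fun restrict_blocks :: "'a set \<Rightarrow> 'a list list \<Rightarrow> ('a list \<times> bool) list" where
  "restrict_blocks U [] = []"
| "restrict_blocks U (B # Bs) =
    (if set B \<inter> U = {} then [] else [(filter (\<lambda>x. x \<in> U) B, hd B \<notin> U)]) @ restrict_blocks U Bs"

text \<open>Allows a finite set of letters to be exchanged for an initial segment of the order.
  Nonempty blocks are required because the flag looks at \<open>hd B\<close>.\<close>

lemma restrict_blocks_cong:
  assumes "\<And>B. B \<in> set Bs \<Longrightarrow> B \<noteq> []" "\<And>x. x \<in> set (concat Bs) \<Longrightarrow> x \<in> U \<longleftrightarrow> x \<in> V"
  shows "restrict_blocks U Bs = restrict_blocks V Bs"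
  using assms
proof (induction Bs)
  case (Cons B Bs)
  have "hd B \<in> set B" using Cons.prems(1) by simp
  moreover have "\<And>x. x \<in> set B \<Longrightarrow> x \<in> U \<longleftrightarrow> x \<in> V" using Cons.prems(2) by simp
  ultimately show ?case using Cons by (auto intro!: filter_cong)
qed simp

lemma restrict_blocks_empty: "restrict_blocks {} Bs = []"
  by (induction Bs) auto

lemma restrict_blocks_full:
  "(\<And>B. B \<in> set Bs \<Longrightarrow> B \<noteq> []) \<Longrightarrow> set (concat Bs) \<subseteq> U \<Longrightarrow>
    restrict_blocks U Bs = map (\<lambda>B. (B, False)) Bs"
proof (induction Bs)
  case (Cons B Bs)
  have "filter (\<lambda>x. x \<in> U) B = B" using Cons.prems(2) by (auto simp: filter_id_conv)
  moreover have "hd B \<in> set B" using Cons.prems(1) by simp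
  then have "hd B \<in> U" "set B \<inter> U \<noteq> {}" using Cons.prems(2) by auto
  ultimately show ?case using Cons by simp
qed simp

lemma decreasing_disjoint_lessThan:
  assumes "sorted_wrt (>) B" "B \<noteq> []"
  shows "set B \<inter> {..<a} = {} \<longleftrightarrow> a \<le> last (B :: 'a::linorder list)"
    and "set B \<inter> {..a} = {} \<longleftrightarrow> a < last B"
proof -
  have "last B \<in> set B" "\<And>x. x \<in> set B \<Longrightarrow> last B \<le> x"
    using assms by (auto intro: decreasing_ge_last)
  then show "set B \<inter> {..<a} = {} \<longleftrightarrow> a \<le> last B" "set B \<inter> {..a} = {} \<longleftrightarrow> a < last B"
    by (auto simp: disjoint_iff not_less not_le intro: order_trans less_le_trans)
qed

text \<open>The open count is visible in the restriction, so lists with equal restrictions have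
  equal counts.\<close>

lemma open_count_restrict_blocks:
  "block_list Bs \<Longrightarrow> open_count a Bs = length (filter snd (restrict_blocks {..<a} Bs))"
  by (induction Bs) (simp_all add: open_count_def decreasing_disjoint_lessThan not_less not_le)

text \<open>If the first block has no letter below \<open>a\<close>, its last letter is at least
  \<open>a\<close>, and so is the head of the next block. Hence the first block that is visible
  still lacks its closer.\<close>

lemma restrict_blocks_hd_open:
  "block_list Bs \<Longrightarrow> Bs \<noteq> [] \<Longrightarrow> a \<le> hd (hd Bs) \<Longrightarrow> restrict_blocks {..<a} Bs = x # xs \<Longrightarrow> snd x"
proof (induction Bs)
  case (Cons B Bs)
  show ?case
  proof (cases "a \<le> last B")
    case True
    then show ?thesis using Cons
      by (cases "Bs = []") (auto simp: decreasing_disjoint_lessThan)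
  next
    case False
    then show ?thesis using Cons.prems by (auto simp: decreasing_disjoint_lessThan)
  qed
qed simp

lemma filter_atMost_decreasing:
  fixes B :: "'a::linorder list"
  assumes "sorted_wrt (>) B"
  shows "filter (\<lambda>x. x \<in> {..a}) B = (if a \<in> set B then [a] else []) @ filter (\<lambda>x. x \<in> {..<a}) B"
  using assms
proof (induction B)
  case (Cons b B)
  show ?case
  proof (cases "b = a")
    case True
    then have "filter (\<lambda>x. x \<in> {..a}) B = filter (\<lambda>x. x \<in> {..<a}) B"
      using Cons.prems by (intro filter_cong) auto
    then show ?thesis using True by simp
  next
    case False
    have "a \<notin> set B" if "b < a" using that Cons.prems by auto
    then show ?thesis using False Cons by auto
  qed
qed simp

section \<open>One step of the scan for two block lists with equal data\<close>

text \<open>Excludes that one list begins with a new block \<open>B\<close> where the other begins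
  with an old block \<open>C\<close>. An open \<open>C\<close> makes the count of \<open>B\<close>
  too large; a closed \<open>C\<close> cannot be the first visible block behind
  \<open>B\<close>.\<close>

lemma new_block_not_after_old:
  assumes Bs: "block_list (B # Bs)" and Cs: "block_list (C # Cs)"
    and restr: "restrict_blocks {..<a} (B # Bs) = restrict_blocks {..<a} (C # Cs)"
    and lab: "open_labels a (B # Bs) = open_labels a (C # Cs)"
    and B: "last B = a" and C: "last C < a"
  shows False
proof -
  have "a \<in> set B" using B Bs by (metis block_list.simps(2) last_in_set)
  define k where "k = open_count a Bs"
  have restr': "restrict_blocks {..<a} Bs = restrict_blocks {..<a} (C # Cs)"
    using restr Bs B by (auto simp: decreasing_disjoint_lessThan)
  have k: "k = open_count a (C # Cs)"
    using restr' Bs Cs open_count_restrict_blocks[of Bs a] open_count_restrict_blocks[of "C # Cs" a]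
    by (simp add: k_def)
  show False
  proof (cases "a \<le> hd C")
    case True
    \<comment> \<open>The label of \<open>B\<close> counts \<open>C\<close> as well, whereas every
      label in \<open>C # Cs\<close> counts at most the open blocks of \<open>Cs\<close>.\<close>
    then have "k = Suc (open_count a Cs)" using k C by (simp add: open_count_def)
    have "(role_in B a, k) \<in> set (open_labels a (C # Cs))"
      using lab[symmetric] \<open>a \<in> set B\<close> by (simp add: k_def)
    then consider "(role_in B a, k) \<in> set (open_labels a Cs)" | "k = open_count a Cs"
      by (auto split: if_splits)
    then show False
      using \<open>k = Suc _\<close> Cs open_labels_bound(1)[of Cs "role_in B a" k a] by cases auto
  next
    case False
    \<comment> \<open>The first visible block of \<open>Bs\<close> is now closed, but
      \<open>a = last B \<le> hd (hd Bs)\<close> would force it to be open.\<close>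
    have "restrict_blocks {..<a} Bs = (filter (\<lambda>x. x \<in> {..<a}) C, False) # restrict_blocks {..<a} Cs"
      using restr' Cs C False by (auto simp: decreasing_disjoint_lessThan)
    moreover from this have "Bs \<noteq> []" by auto
    ultimately have "\<not> a \<le> hd (hd Bs)"
      using restrict_blocks_hd_open[of Bs a] Bs by auto
    then show False using Bs B \<open>Bs \<noteq> []\<close> by simp
  qed
qed

text \<open>If \<open>a\<close> were missing from \<open>C\<close>, the label of the copy in
  \<open>B\<close> would occur in \<open>Cs\<close>, where an insider or closer counts strictly
  fewer than all open blocks of \<open>Cs\<close>.\<close>

lemma extended_block_agree:
  assumes Bs: "block_list (B # Bs)" and Cs: "block_list (C # Cs)"
    and count: "open_count a Bs = open_count a Cs"
    and lab: "open_labels a (B # Bs) = open_labels a (C # Cs)"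
    and B: "last B < a" and a: "a \<in> set B"
  shows "a \<in> set C"
proof (rule ccontr)
  assume "a \<notin> set C"
  then have "(role_in B a, open_count a Bs) \<in> set (open_labels a Cs)"
    using lab[symmetric] a by simp
  moreover have "role_in B a = Insider \<or> role_in B a = Closer"
    using role_in_cases[of B a] a Bs B by (cases "role_in B a") auto
  ultimately show False using open_labels_bound(2)[of Cs _ _ a] Cs count by fastforce
qed

text \<open>Both lists are traversed in parallel. A block entirely above \<open>a\<close> is
  invisible and is dropped on its side alone, hence the induction on the total length.\<close>

lemma restrict_blocks_step:
  fixes a :: "'a::linorder"
  assumes "block_list Bs" "block_list Cs"
    and "restrict_blocks {..<a} Bs = restrict_blocks {..<a} Cs"
    and "open_labels a Bs = open_labels a Cs"
  shows "restrict_blocks {..a} Bs = restrict_blocks {..a} Cs"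
  using assms
proof (induction "length Bs + length Cs" arbitrary: Bs Cs rule: less_induct)
  case less
  have skip: "restrict_blocks {..<a} (B # Bs) = restrict_blocks {..<a} Bs"
      "restrict_blocks {..a} (B # Bs) = restrict_blocks {..a} Bs"
      "open_labels a (B # Bs) = open_labels a Bs"
    if "block_list (B # Bs)" "a < last B" for B and Bs :: "'a list list"
  proof -
    have "a \<notin> set B" using that decreasing_ge_last[of B a] by auto
    then show "restrict_blocks {..<a} (B # Bs) = restrict_blocks {..<a} Bs"
      "restrict_blocks {..a} (B # Bs) = restrict_blocks {..a} Bs"
      "open_labels a (B # Bs) = open_labels a Bs"
      using that by (auto simp: decreasing_disjoint_lessThan)
  qed
  \<comment> \<open>Used when one list is exhausted: the other then has neither smaller letters nor
    copies of \<open>a\<close>.\<close>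
  have empty: "restrict_blocks {..a} Bs = []"
    if "block_list Bs" "restrict_blocks {..<a} Bs = []" "open_labels a Bs = []" for Bs
    using that
  proof (induction Bs)
    case (Cons B Bs)
    then have "a \<le> last B" "a \<notin> set B"
      by (auto simp: decreasing_disjoint_lessThan split: if_splits)
    moreover have "last B \<in> set B" using Cons.prems by simp
    ultimately have "a < last B" by (metis order_le_less)
    then show ?case using skip(2)[of B Bs] Cons by simp
  qed simp
  show ?case
  proof (cases "Bs = [] \<or> Cs = []")
    case True
    then show ?thesis using less.prems empty by auto
  next
    case False
    then obtain B Bs' C Cs' where eq: "Bs = B # Bs'" "Cs = C # Cs'" by (auto simp: neq_Nil_conv)
    have IH: "restrict_blocks {..a} Bs' = restrict_blocks {..a} Cs'"
      if "restrict_blocks {..<a} Bs' = restrict_blocks {..<a} Cs'" "open_labels a Bs' = open_labels a Cs'"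
      using less.hyps[of Bs' Cs'] less.prems eq that by simp
    have ne: "B \<noteq> []" "C \<noteq> []" and dec: "sorted_wrt (>) B" "sorted_wrt (>) C"
      and bl: "block_list Bs'" "block_list Cs'" using less.prems eq by auto
    note simps = decreasing_disjoint_lessThan[OF dec(1) ne(1)] decreasing_disjoint_lessThan[OF dec(2) ne(2)]
    \<comment> \<open>The last letter is the least of its block: above \<open>a\<close> the block is
      invisible, equal to \<open>a\<close> it is new, below \<open>a\<close> it is old.\<close>
    consider "a < last B" | "a < last C" | (new) "last B = a" "last C = a"
      | "last B = a" "last C < a" | "last B < a" "last C = a" | (old) "last B < a" "last C < a"
      by (metis linorder_less_linear)
    then show ?thesis
    proof cases
      case 1
      then have "restrict_blocks {..a} Bs' = restrict_blocks {..a} Cs"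
        using less.hyps[of Bs' Cs] less.prems skip[of B Bs'] eq by simp
      then show ?thesis using skip[of B Bs'] 1 less.prems eq by simp
    next
      case 2
      then have "restrict_blocks {..a} Bs = restrict_blocks {..a} Cs'"
        using less.hyps[of Bs Cs'] less.prems skip[of C Cs'] eq by simp
      then show ?thesis using skip[of C Cs'] 2 less.prems eq by simp
    next
      case new
      have mem: "a \<in> set B" "a \<in> set C" using new ne by (metis last_in_set)+
      then have "role_in B a = role_in C a" "open_labels a Bs' = open_labels a Cs'"
        using less.prems(4) eq by auto
      \<comment> \<open>The common role, opener or outsider, decides whether the new block is
        open.\<close>
      moreover from this(1) have "hd B \<le> a \<longleftrightarrow> hd C \<le> a"
        using role_in_cases[OF dec(1) mem(1)] role_in_cases[OF dec(2) mem(2)] new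
          decreasing_le_hd[OF dec(1) mem(1)] decreasing_le_hd[OF dec(2) mem(2)]
        by (metis order_le_less not_le)
      moreover have "filter (\<lambda>x. x \<in> {..<a}) B = []" "filter (\<lambda>x. x \<in> {..<a}) C = []"
        using new decreasing_ge_last[OF dec(1)] decreasing_ge_last[OF dec(2)]
        by (auto simp: filter_empty_conv not_less)
      then have "filter (\<lambda>x. x \<in> {..a}) B = [a]" "filter (\<lambda>x. x \<in> {..a}) C = [a]"
        using mem filter_atMost_decreasing[OF dec(1), of a] filter_atMost_decreasing[OF dec(2), of a]
        by simp_all
      moreover have "restrict_blocks {..<a} Bs' = restrict_blocks {..<a} Cs'"
        using less.prems(3) eq new simps by simp
      ultimately show ?thesis using IH eq new simps by simp
    next
      case 4
      then show ?thesis using new_block_not_after_old less.prems eq by blast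
    next
      case 5
      then show ?thesis
        using new_block_not_after_old[of C Cs' B Bs' a] less.prems eq by simp
    next
      case old
      then have heads: "filter (\<lambda>x. x \<in> {..<a}) B = filter (\<lambda>x. x \<in> {..<a}) C" "hd B < a \<longleftrightarrow> hd C < a"
        and tails: "restrict_blocks {..<a} Bs' = restrict_blocks {..<a} Cs'"
        using less.prems(3) by (auto simp: eq simps not_le[symmetric] simp del: not_le)
      have "open_count a Bs' = open_count a Cs'"
        using tails bl by (simp add: open_count_restrict_blocks)
      then have mem: "a \<in> set B \<longleftrightarrow> a \<in> set C"
        using extended_block_agree[of B Bs' C Cs' a] extended_block_agree[of C Cs' B Bs' a]
          less.prems(1,2,4)[unfolded eq] old by metis
      then have lab: "open_labels a Bs' = open_labels a Cs'"
        and role: "a \<in> set B \<Longrightarrow> role_in B a = role_in C a"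
        using less.prems(4) eq by (auto split: if_splits)
      \<comment> \<open>If \<open>a\<close> extends both blocks, the common role tells whether it
        closes them; if it extends neither, both flags stay as they were.\<close>
      have "hd B \<le> a \<longleftrightarrow> hd C \<le> a"
      proof (cases "a \<in> set B")
        case True
        then show ?thesis
          using role mem role_in_cases[OF dec(1), of a] role_in_cases[OF dec(2), of a] old
            decreasing_le_hd[OF dec(1), of a] decreasing_le_hd[OF dec(2), of a]
          by (metis order_le_less not_le)
      next
        case False
        then have "hd B \<noteq> a" "hd C \<noteq> a" using mem ne by (metis hd_in_set)+
        then show ?thesis using heads(2) by auto
      qed
      moreover have "filter (\<lambda>x. x \<in> {..a}) B = filter (\<lambda>x. x \<in> {..a}) C"
        using filter_atMost_decreasing[OF dec(1), of a] filter_atMost_decreasing[OF dec(2), of a]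
          heads(1) mem by simp
      ultimately show ?thesis using IH[OF tails lab] eq old simps by auto
    qed
  qed
qed

text \<open>The scan itself: the restrictions agree for every initial segment of the occurring
  letters, and the full segment returns the lists.\<close>

lemma block_list_eq_if_labels_eq:
  fixes Bs Cs :: "'a::linorder list list"
  assumes Bs: "block_list Bs" and Cs: "block_list Cs"
    and lab: "\<And>a. labels a Bs = labels a Cs"
  shows "Bs = Cs"
proof -
  \<comment> \<open>Taking the letters of both lists lets the same segments serve for both.\<close>
  define S where "S = set (concat Bs) \<union> set (concat Cs)"
  have ne: "\<And>B. B \<in> set Bs \<Longrightarrow> B \<noteq> []" "\<And>B. B \<in> set Cs \<Longrightarrow> B \<noteq> []"
    using Bs Cs block_list_nonempty by auto
  have "restrict_blocks U Bs = restrict_blocks U Cs"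
    if "finite U" "U \<subseteq> S" "\<And>x y. x \<in> S \<Longrightarrow> y \<in> U \<Longrightarrow> x < y \<Longrightarrow> x \<in> U" for U
    using that
  proof (induction U rule: finite_linorder_max_induct)
    case empty
    show ?case by (simp add: restrict_blocks_empty)
  next
    case (insert a U)
    have "x \<in> U" if "x \<in> S" "y \<in> U" "x < y" for x y
      using insert.prems(2)[of x y] that insert.hyps(2) by auto
    then have IH: "restrict_blocks U Bs = restrict_blocks U Cs"
      using insert.IH insert.prems(1) by blast
    \<comment> \<open>Since \<open>insert a U\<close> is downward closed in \<open>S\<close> and
      \<open>a\<close> exceeds all of \<open>U\<close>, these sets meet \<open>S\<close> in the same
      letters as \<open>{..<a}\<close> and \<open>{..a}\<close>.\<close>
    have U: "x \<in> U \<longleftrightarrow> x \<in> {..<a}" "x \<in> insert a U \<longleftrightarrow> x \<in> {..a}" if "x \<in> S" for x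
      using that insert.hyps(2) insert.prems(2)[of x a] by (auto simp: order_le_less)
    have "restrict_blocks {..<a} Bs = restrict_blocks U Bs" "restrict_blocks {..<a} Cs = restrict_blocks U Cs"
      using U(1) ne by (intro restrict_blocks_cong; auto simp: S_def)+
    then have "restrict_blocks {..a} Bs = restrict_blocks {..a} Cs"
      using restrict_blocks_step[OF Bs Cs] IH open_labels_eq Bs Cs lab by metis
    moreover have "restrict_blocks (insert a U) Bs = restrict_blocks {..a} Bs"
      "restrict_blocks (insert a U) Cs = restrict_blocks {..a} Cs"
      using U(2) ne by (intro restrict_blocks_cong; auto simp: S_def)+
    ultimately show ?case by simp
  qed
  from this[of S] have "restrict_blocks S Bs = restrict_blocks S Cs" by (simp add: S_def)
  then have "map (\<lambda>B. (B, False)) Bs = map (\<lambda>B. (B, False)) Cs"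
    using restrict_blocks_full[of Bs S] restrict_blocks_full[of Cs S] ne by (simp add: S_def)
  then show ?thesis by (auto dest!: map_injective simp: inj_def)
qed

text \<open>The set determines the label lists, these determine the block list, and the word is its
  concatenation.\<close>

lemma inj_delta: "inj delta"
proof (rule injI)
  fix v w :: "'a list"
  assume eq: "delta v = delta w"
  obtain Bs Cs where *: "block_list Bs" "concat Bs = v" "block_list Cs" "concat Cs = w"
    using block_list_exists[of v] block_list_exists[of w] by blast
  then have "labels a Bs = labels a Cs" for a using labels_eq_if_delta_eq eq by blast
  then have "Bs = Cs" using * block_list_eq_if_labels_eq by blast
  then show "v = w" using * by blast
qed

theorem mainTheorem4:
  fixes A :: "'a::linorder set" and m :: "'a \<Rightarrow> nat"
  assumes "finite A"
    and "\<And>a. a \<in> A \<Longrightarrow> m a > 0"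
  shows "bij_betw delta (words_over A m) (L_words A m)"
proof -
  have "delta ` words_over A m = L_words A m" by (auto simp: L_words_def)
  then show ?thesis using inj_delta by (auto simp: bij_betw_def intro: inj_on_subset)
qed

end
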